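(* Let $1 \leq t \leq r$, let $\mathcal{F}$ be a $(\leq r)$-family, let $m \geq c(r,r,t)$, and let $\mathcal{F}_1 = \dots = \mathcal{F}_k = \mathcal{S}_{\mathcal{F},m}$ (with $k\geq 2$). Then $(\mathcal{F}_1, \dots, \mathcal{F}_k)$ has the extrastrong cross-$t$-star property.
   Context: All sets and families are finite. For an $r$-element set $X=\{x_1,\dots,x_r\}$ and integer $m\geq1$, $\mathcal{S}_{X,m}=\{\{(x_1,y_1),\dots,(x_r,y_r)\}: y_1,\dots,y_r\in[m]\}$, with $\mathcal{S}_{\emptyset,m}=\emptyset$; $\mathcal{S}_{\mathcal{F},m}=\bigcup_{F\in\mathcal{F}}\mathcal{S}_{F,m}$. A $(\leq r)$-family is one whose sets each have at most $r$ elements. For $t\le r$, $c(r,r,t)=r\binom{r}{t}+1$. $\mathcal{G}(T)=\{G\in\mathcal{G}:T\subseteq G\}$. Families $\mathcal{A}_1,\dots,\mathcal{A}_k$ are cross-$t$-intersecting if for all distinct $i,j$ each set of $\mathcal{A}_i$ shares at least $t$ elements with each set of $\mathcal{A}_j$; the tuple is below $(\mathcal{F}_1,\dots,\mathcal{F}_k)$ if $\mathcal{A}_i\subseteq\mathcal{F}_i$. $(\mathcal{F}_1,\dots,\mathcal{F}_k)$ has the extrastrong cross-$t$-star property if there is a $t$-set $T$ such that for every cross-$t$-intersecting tuple below it, $\prod|\mathcal{A}_i|\leq\prod|\mathcal{F}_i(T)|$, with equality only if there is a $t$-set $T'$ with $\mathcal{A}_i=\mathcal{F}_i(T')$ for all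 $i$.
   Formalization: Assumes in addition that if S_{F,m} is nonempty then some set of F has at least t elements; otherwise all t-stars are empty and A_1 = S_{F,m}, A_2 = ... = A_k = ∅ attains equality 0 = 0 without being stars, so the printed claim fails. *)

theory Defs
  imports Main
begin

text \<open>A tuple of families indexed by \<open>1, \<dots>, k\<close> is a function on \<^typ>\<open>nat\<close> of which only the
  values on \<open>{1..k}\<close> matter.\<close>

definition le_family :: "nat \<Rightarrow> 'a set set \<Rightarrow> bool" where
  "le_family r \<F> \<longleftrightarrow> finite \<F> \<and> (\<forall>X\<in>\<F>. finite X \<and> card X \<le> r)"

text \<open>For \<open>X = {x\<^sub>1, \<dots>, x\<^sub>r}\<close> the set \<open>{(x\<^sub>1, y\<^sub>1), \<dots>, (x\<^sub>r, y\<^sub>r)}\<close> is the graph over \<open>X\<close> of the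
  labelling \<open>x\<^sub>i \<mapsto> y\<^sub>i\<close>. For \<open>X = {}\<close> this would give the family \<open>{{}}\<close>; the convention is
  that the family is empty.\<close>

definition signed_sets :: "'a set \<Rightarrow> nat \<Rightarrow> ('a \<times> nat) set set" where
  "signed_sets X m =
     (if X = {} then {} else {(\<lambda>x. (x, y x)) ` X | y. \<forall>x\<in>X. y x \<in> {1..m}})"

definition signed_family :: "'a set set \<Rightarrow> nat \<Rightarrow> ('a \<times> nat) set set" where
  "signed_family \<F> m = (\<Union>X\<in>\<F>. signed_sets X m)"

definition star :: "'a set set \<Rightarrow> 'a set \<Rightarrow> 'a set set" where
  "star \<G> T = {G \<in> \<G>. T \<subseteq> G}"

definition cross_t_intersecting :: "nat \<Rightarrow> nat \<Rightarrow> (nat \<Rightarrow> 'a set set) \<Rightarrow> bool" where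
  "cross_t_intersecting t k \<A> \<longleftrightarrow>
     (\<forall>i\<in>{1..k}. \<forall>j\<in>{1..k}. i \<noteq> j \<longrightarrow> (\<forall>A\<in>\<A> i. \<forall>B\<in>\<A> j. t \<le> card (A \<inter> B)))"

definition below :: "nat \<Rightarrow> (nat \<Rightarrow> 'a set set) \<Rightarrow> (nat \<Rightarrow> 'a set set) \<Rightarrow> bool" where
  "below k \<A> \<F> \<longleftrightarrow> (\<forall>i\<in>{1..k}. \<A> i \<subseteq> \<F> i)"

definition extrastrong_cross_t_star :: "nat \<Rightarrow> nat \<Rightarrow> (nat \<Rightarrow> 'a set set) \<Rightarrow> bool" where
  "extrastrong_cross_t_star t k \<F> \<longleftrightarrow>
     (\<exists>T. finite T \<and> card T = t \<and>
       (\<forall>\<A>. below k \<A> \<F> \<and> cross_t_intersecting t k \<A> \<longrightarrow>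
          (\<Prod>i=1..k. card (\<A> i)) \<le> (\<Prod>i=1..k. card (star (\<F> i) T)) \<and>
          ((\<Prod>i=1..k. card (\<A> i)) = (\<Prod>i=1..k. card (star (\<F> i) T)) \<longrightarrow>
             (\<exists>T'. finite T' \<and> card T' = t \<and> (\<forall>i\<in>{1..k}. \<A> i = star (\<F> i) T')))))"

end

theory Submission
  imports Defs
begin

text \<open>Let \<open>M\<close> be the largest size of a star \<open>\<G>(T)\<close> over \<open>t\<close>-sets \<open>T\<close>. Relabelling one point shows
  that adding a point to \<open>T\<close> divides the size of the star by at least \<open>m\<close>. If two cross-\<open>t\<close>-intersecting
  families \<open>\<A>\<close>, \<open>\<B>\<close> do not lie in a common star, then either \<open>\<A>\<close> lies in a star \<open>\<G>(T)\<close> and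
  some \<open>B \<in> \<B>\<close> misses a point of \<open>T\<close>, so that all members of \<open>\<A>\<close> contain \<open>T\<close> and one of the
  at most \<open>r\<close> points of \<open>B - T\<close>, which gives \<open>|\<A>| \<le> rM/m\<close> against the trivial
  \<open>|\<B>| \<le> (r choose t) M\<close>; or symmetrically; or neither family lies in a star, and then
  both have size at most \<open>r (r choose t) M/m < M\<close>. In each case \<open>|\<A>||\<B>| < M\<^sup>2\<close>, and the
  case of \<open>k\<close> families follows from that of pairs because at most one of them can have more
  than \<open>M\<close> members.\<close>

section \<open>Signed sets and the relabelling bound for stars\<close>

lemma finite_star: "finite \<G> \<Longrightarrow> finite (star \<G> T)"
  by (simp add: star_def)

text \<open>Signed sets are nonempty graphs of functions into \<open>{1..m}\<close>, so they can be
  recognised without naming a labelling. The condition \<open>S \<noteq> {}\<close> carries the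
  convention for the empty ground set.\<close>

lemma mem_signed_family_iff:
  "S \<in> signed_family \<F> m \<longleftrightarrow>
     S \<noteq> {} \<and> inj_on fst S \<and> fst ` S \<in> \<F> \<and> snd ` S \<subseteq> {1..m}"
proof
  assume "S \<in> signed_family \<F> m"
  then obtain X y where "X \<in> \<F>" "X \<noteq> {}" "S = (\<lambda>x. (x, y x)) ` X" "\<forall>x\<in>X. y x \<in> {1..m}"
    by (auto simp: signed_family_def signed_sets_def split: if_splits)
  then show "S \<noteq> {} \<and> inj_on fst S \<and> fst ` S \<in> \<F> \<and> snd ` S \<subseteq> {1..m}"
    by (auto simp: inj_on_def image_image)
next
  assume S: "S \<noteq> {} \<and> inj_on fst S \<and> fst ` S \<in> \<F> \<and> snd ` S \<subseteq> {1..m}"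
  define y where "y x = snd (the_inv_into S fst x)" for x
  have y: "y (fst p) = snd p" if "p \<in> S" for p
    using S that by (simp add: y_def the_inv_into_f_f)
  have "S = (\<lambda>x. (x, y x)) ` fst ` S"
    by (simp add: image_image y)
  moreover have "\<forall>x\<in>fst ` S. y x \<in> {1..m}"
    using S y by fastforce
  ultimately have "S \<in> signed_sets (fst ` S) m"
    using S unfolding signed_sets_def by auto
  then show "S \<in> signed_family \<F> m"
    using S by (auto simp: signed_family_def)
qed

lemma signed_family_finite_card:
  assumes "le_family r \<F>" and "S \<in> signed_family \<F> m"
  shows "finite S" and "card S \<le> r"
proof -
  have S: "inj_on fst S" "finite (fst ` S)" "card (fst ` S) \<le> r"
    using assms by (auto simp: mem_signed_family_iff le_family_def)
  then show "finite S" by (simp add: finite_image_iff)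
  show "card S \<le> r" using S by (simp add: card_image)
qed

lemma finite_signed_family:
  assumes "le_family r \<F>"
  shows "finite (signed_family \<F> m)"
proof (rule finite_subset)
  show "signed_family \<F> m \<subseteq> Pow (\<Union>\<F> \<times> {1..m})"
  proof (intro subsetI PowI)
    fix S p assume "S \<in> signed_family \<F> m" and p: "p \<in> S"
    then have "fst ` S \<in> \<F>" "snd ` S \<subseteq> {1..m}"
      by (auto simp: mem_signed_family_iff)
    then show "p \<in> \<Union>\<F> \<times> {1..m}"
      using imageI[OF p, of fst] imageI[OF p, of snd] by (subst mem_Times_iff) blast
  qed
  show "finite (Pow (\<Union>\<F> \<times> {1..m}))"
    using assms by (auto simp: le_family_def)
qed

text \<open>Each member of the smaller star yields \<open>m\<close> members of the larger one, by
  giving the first coordinate of \<open>p\<close> each of the \<open>m\<close> labels. The results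
  still contain \<open>T\<close> because \<open>p \<notin> T\<close>.\<close>

lemma card_star_insert_signed_family:
  assumes "le_family r \<F>" and "p \<notin> T"
  shows "m * card (star (signed_family \<F> m) (insert p T)) \<le> card (star (signed_family \<F> m) T)"
proof -
  obtain a b where p: "p = (a, b)" by (cases p)
  let ?G = "signed_family \<F> m"
  let ?D = "star ?G (insert p T)"
  define \<phi> where "\<phi> = (\<lambda>(S, c). insert (a, c) (S - {p}))"
  \<comment> \<open>A member through \<open>p\<close> has no other point over \<open>a\<close>.
    Hence the new point \<open>(a, c)\<close> can be read off from the image, and removing it
    recovers \<open>S - {p}\<close>.\<close>
  have only: "c = b" if "S \<in> ?D" "(a, c) \<in> S" for S c
    using that p by (force simp: star_def mem_signed_family_iff inj_on_def)
  have "inj_on \<phi> (?D \<times> {1..m})"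
  proof (rule inj_onI, clarify)
    fix S c S' c'
    assume S: "S \<in> ?D" and S': "S' \<in> ?D" and eq: "\<phi> (S, c) = \<phi> (S', c')"
    have notin: "(a, d) \<notin> S - {p}" "(a, d) \<notin> S' - {p}" for d
      using only[OF S] only[OF S'] p by auto
    have "(a, c) \<in> insert (a, c') (S' - {p})"
      using eq by (auto simp: \<phi>_def)
    then have c: "c = c'"
      using notin by auto
    have "S - {p} = S' - {p}"
      using eq c notin unfolding \<phi>_def by (simp add: insert_ident)
    moreover have "p \<in> S" "p \<in> S'"
      using S S' by (auto simp: star_def)
    ultimately show "S = S' \<and> c = c'"
      using c by blast
  qed
  moreover have "\<phi> ` (?D \<times> {1..m}) \<subseteq> star ?G T"
  proof clarify
    fix S c assume S: "S \<in> ?D" and c: "c \<in> {1..m}"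
    have mem: "S \<in> ?G" "p \<in> S" "T \<subseteq> S"
      using S by (auto simp: star_def)
    have "fst ` \<phi> (S, c) = fst ` S"
      using mem(2) p by (force simp: \<phi>_def)
    moreover have "inj_on fst (\<phi> (S, c))"
      using mem(1) only[OF S] p
      by (force simp: \<phi>_def mem_signed_family_iff inj_on_def)
    moreover have "snd ` \<phi> (S, c) \<subseteq> {1..m}"
      using mem(1) c by (auto simp: \<phi>_def mem_signed_family_iff image_subset_iff)
    moreover have "T \<subseteq> \<phi> (S, c)"
      using mem(3) assms(2) by (auto simp: \<phi>_def)
    ultimately show "\<phi> (S, c) \<in> star ?G T"
      using mem(1) by (auto simp: star_def mem_signed_family_iff \<phi>_def)
  qed
  ultimately have "card (?D \<times> {1..m}) \<le> card (star ?G T)"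
    by (rule card_inj_on_le) (intro finite_star finite_signed_family[OF assms(1)])
  then show ?thesis
    by (simp add: card_cartesian_product mult.commute)
qed

section \<open>Cross-intersecting pairs in a family with spread stars\<close>

text \<open>Isolates what the pair argument needs from signed families. Here \<open>M\<close> is any
  positive bound for the \<open>t\<close>-stars that also satisfies \<open>star_insert_le\<close>;
  in the application it is the largest star size.\<close>

locale spread_family =
  fixes \<G> :: "'b set set" and r t m M :: nat
  assumes fin: "finite \<G>"
    and fin_mem: "S \<in> \<G> \<Longrightarrow> finite S"
    and card_mem: "S \<in> \<G> \<Longrightarrow> card S \<le> r"
    and star_le: "finite T \<Longrightarrow> card T = t \<Longrightarrow> card (star \<G> T) \<le> M"
    and star_insert_le: "finite T \<Longrightarrow> card T = t \<Longrightarrow> p \<notin> T \<Longrightarrow>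
      m * card (star \<G> (insert p T)) \<le> M"
    and large: "r * (r choose t) < m"
    and M_pos: "0 < M"
begin

text \<open>A member of \<open>P\<close> meets \<open>B\<close> in at least \<open>t\<close> points,
  and these cannot all lie in \<open>T\<close>, as then \<open>T \<subseteq> B\<close>. So it
  contains \<open>T\<close> and some point of \<open>B - T\<close>, and a union bound over at most
  \<open>r\<close> such points applies.\<close>

lemma card_le_missing_point:
  assumes T: "finite T" "card T = t" and P: "P \<subseteq> star \<G> T"
    and B: "B \<in> \<G>" "\<not> T \<subseteq> B" and cross: "\<forall>A\<in>P. t \<le> card (A \<inter> B)"
  shows "m * card P \<le> r * M"
proof -
  have "P \<subseteq> (\<Union>p\<in>B - T. star \<G> (insert p T))"
  proof
    fix A assume A: "A \<in> P"
    then have A': "A \<in> \<G>" "T \<subseteq> A" using subsetD[OF P] by (auto simp: star_def)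
    have "\<not> A \<inter> B \<subseteq> T"
    proof
      assume "A \<inter> B \<subseteq> T"
      then have "A \<inter> B = T"
        using T(2) cross A by (intro card_seteq[OF T(1)]) auto
      then show False using B by blast
    qed
    then show "A \<in> (\<Union>p\<in>B - T. star \<G> (insert p T))"
      using A' by (auto simp: star_def)
  qed
  then have "card P \<le> card (\<Union>p\<in>B - T. star \<G> (insert p T))"
    using fin fin_mem[OF B(1)] by (intro card_mono) (auto intro: finite_star)
  also have "\<dots> \<le> (\<Sum>p\<in>B - T. card (star \<G> (insert p T)))"
    using fin_mem[OF B(1)] by (intro card_UN_le) auto
  finally have "m * card P \<le> (\<Sum>p\<in>B - T. m * card (star \<G> (insert p T)))"
    by (metis mult_le_mono2 sum_distrib_left)
  also have "\<dots> \<le> card (B - T) * M"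
    using sum_bounded_above[of "B - T" "\<lambda>p. m * card (star \<G> (insert p T))" M]
      star_insert_le[OF T] by simp
  also have "card (B - T) \<le> r"
    using card_mem[OF B(1)] card_mono[OF fin_mem[OF B(1)], of "B - T"] by simp
  finally show ?thesis by simp
qed

text \<open>Every member of \<open>P\<close> contains one of the \<open>t\<close>-subsets of
  \<open>A\<close>, which number at most \<open>r choose t\<close>. The factor \<open>c\<close>
  permits both the trivial star bound (\<open>c = 1\<close>) and the bound from a missed point
  (\<open>c = m\<close>).\<close>

lemma card_le_choose_bound:
  assumes A: "A \<in> \<G>" and P: "P \<subseteq> \<G>" and cross: "\<forall>B\<in>P. t \<le> card (A \<inter> B)"
    and bound: "\<And>T. finite T \<Longrightarrow> card T = t \<Longrightarrow> c * card (P \<inter> star \<G> T) \<le> N"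
  shows "c * card P \<le> (r choose t) * N"
proof -
  let ?I = "{T. T \<subseteq> A \<and> card T = t}"
  have finA: "finite A" and finI: "finite ?I"
    using fin_mem[OF A] by auto
  have "P \<subseteq> (\<Union>T\<in>?I. P \<inter> star \<G> T)"
  proof
    fix B assume B: "B \<in> P"
    then obtain T where "T \<subseteq> A \<inter> B" "card T = t"
      using cross obtain_subset_with_card_n by metis
    then show "B \<in> (\<Union>T\<in>?I. P \<inter> star \<G> T)"
      using B P by (auto simp: star_def)
  qed
  then have "card P \<le> card (\<Union>T\<in>?I. P \<inter> star \<G> T)"
    using fin finI finite_star[of \<G>] by (intro card_mono) auto
  also have "\<dots> \<le> (\<Sum>T\<in>?I. card (P \<inter> star \<G> T))"
    using finI by (intro card_UN_le)
  finally have "c * card P \<le> (\<Sum>T\<in>?I. c * card (P \<inter> star \<G> T))"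
    by (metis mult_le_mono2 sum_distrib_left)
  also have "\<dots> \<le> card ?I * N"
    using sum_bounded_above[of ?I "\<lambda>T. c * card (P \<inter> star \<G> T)" N] bound
      finite_subset[OF _ finA] by simp
  also have "\<dots> = (card A choose t) * N"
    using n_subsets[OF finA] by simp
  also have "\<dots> \<le> (r choose t) * N"
    using card_mem[OF A] by (intro mult_right_mono binomial_right_mono) auto
  finally show ?thesis .
qed

lemma card_mult_less_one_star:
  assumes sub: "A \<subseteq> \<G>" "B \<subseteq> \<G>" and ne: "A \<noteq> {}"
    and cross: "\<forall>X\<in>A. \<forall>Y\<in>B. t \<le> card (X \<inter> Y)"
    and T: "finite T" "card T = t" "A \<subseteq> star \<G> T" and nB: "\<not> B \<subseteq> star \<G> T"
  shows "card A * card B < M * M"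
proof -
  obtain Y where Y: "Y \<in> B" "\<not> T \<subseteq> Y"
    using nB sub by (auto simp: star_def)
  then have a: "m * card A \<le> r * M"
    using cross sub by (intro card_le_missing_point[OF T, of Y]) auto
  obtain X where X: "X \<in> A" using ne by blast
  have "1 * card (B \<inter> star \<G> T') \<le> M" if "finite T'" "card T' = t" for T'
    using star_le[OF that] card_mono[OF finite_star[OF fin], of "B \<inter> star \<G> T'" T'] by simp
  then have b: "card B \<le> (r choose t) * M"
    using card_le_choose_bound[of X B 1 M] X sub cross by auto
  \<comment> \<open>The factor \<open>m\<close> comes from the bound on \<open>A\<close> alone; it
    beats the combined loss \<open>r * (r choose t)\<close>.\<close>
  have "m * (card A * card B) \<le> (r * M) * ((r choose t) * M)"
    using mult_mono[OF a b] by (simp add: mult.assoc)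
  also have "\<dots> = (r * (r choose t)) * (M * M)"
    by (simp add: algebra_simps)
  also have "\<dots> < m * (M * M)"
    using large M_pos by simp
  finally show ?thesis by simp
qed

text \<open>For each \<open>t\<close>-set \<open>T\<close> some member of \<open>A\<close> misses a
  point of \<open>T\<close>, which bounds the part of \<open>B\<close> in the star of
  \<open>T\<close>. Summing over the \<open>t\<close>-subsets of one fixed member of
  \<open>A\<close> loses only a factor \<open>r choose t\<close>.\<close>

lemma card_less_no_star:
  assumes sub: "A \<subseteq> \<G>" "B \<subseteq> \<G>" and ne: "A \<noteq> {}"
    and cross: "\<forall>X\<in>A. \<forall>Y\<in>B. t \<le> card (X \<inter> Y)"
    and no: "\<And>T. finite T \<Longrightarrow> card T = t \<Longrightarrow> \<not> A \<subseteq> star \<G> T"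
  shows "card B < M"
proof -
  obtain X where X: "X \<in> A" using ne by blast
  have "m * card (B \<inter> star \<G> T) \<le> r * M" if T: "finite T" "card T = t" for T
  proof -
    obtain X' where "X' \<in> A" "\<not> T \<subseteq> X'"
      using no[OF T] sub by (auto simp: star_def)
    then show ?thesis
      using cross sub by (intro card_le_missing_point[OF T, of _ X']) (auto simp: Int_commute)
  qed
  then have "m * card B \<le> (r choose t) * (r * M)"
    using card_le_choose_bound[of X B m "r * M"] X sub cross by auto
  also have "\<dots> = (r * (r choose t)) * M"
    by simp
  also have "\<dots> < m * M"
    using large M_pos by simp
  finally show ?thesis by simp
qed

lemma common_star_or_card_mult_less:
  assumes sub: "A \<subseteq> \<G>" "B \<subseteq> \<G>" and cross: "\<forall>X\<in>A. \<forall>Y\<in>B. t \<le> card (X \<inter> Y)"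
  shows "(\<exists>T. finite T \<and> card T = t \<and> A \<subseteq> star \<G> T \<and> B \<subseteq> star \<G> T) \<or> card A * card B < M * M"
proof (cases "A = {} \<or> B = {}")
  case True
  then show ?thesis using M_pos by auto
next
  case False
  then have ne: "A \<noteq> {}" "B \<noteq> {}" by auto
  have cross': "\<forall>Y\<in>B. \<forall>X\<in>A. t \<le> card (Y \<inter> X)"
    using cross by (subst Int_commute) blast
  consider T where "finite T" "card T = t" "A \<subseteq> star \<G> T"
    | T where "finite T" "card T = t" "B \<subseteq> star \<G> T"
    | "\<And>T. finite T \<Longrightarrow> card T = t \<Longrightarrow> \<not> A \<subseteq> star \<G> T \<and> \<not> B \<subseteq> star \<G> T"
    by blast
  then show ?thesis
  proof cases
    case 1
    then show ?thesis
      using card_mult_less_one_star[OF sub ne(1) cross] by blast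
  next
    case 2
    then show ?thesis
      using card_mult_less_one_star[OF sub(2,1) ne(2) cross'] by (metis mult.commute)
  next
    case 3
    then have "card A < M" "card B < M"
      using card_less_no_star[OF sub ne(1) cross] card_less_no_star[OF sub(2,1) ne(2) cross']
      by blast+
    then show ?thesis by (simp add: mult_strict_mono)
  qed
qed

lemma card_mult_less_or_eq_star:
  assumes sub: "A \<subseteq> \<G>" "B \<subseteq> \<G>" and cross: "\<forall>X\<in>A. \<forall>Y\<in>B. t \<le> card (X \<inter> Y)"
  shows "card A * card B < M * M \<or>
    (\<exists>T. finite T \<and> card T = t \<and> card (star \<G> T) = M \<and> A = star \<G> T \<and> B = star \<G> T)"
proof (cases "card A * card B < M * M")
  case False
  then obtain T where T: "finite T" "card T = t" "A \<subseteq> star \<G> T" "B \<subseteq> star \<G> T"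
    using common_star_or_card_mult_less[OF assms] by auto
  have le: "card A \<le> M" "card B \<le> M"
    using T star_le[of T] card_mono[OF finite_star[OF fin]] by (meson le_trans)+
  \<comment> \<open>Two factors of size at most \<open>M\<close> with product at least
    \<open>M * M\<close> must both equal \<open>M\<close>; each family then fills the star
    containing it.\<close>
  have eq: "card A = M" "card B = M"
  proof -
    have "M * M \<le> card A * M" "M * M \<le> M * card B"
      using False le by (meson le_refl mult_le_mono not_le le_trans)+
    then show "card A = M" "card B = M"
      using M_pos le by auto
  qed
  then have "A = star \<G> T" "B = star \<G> T"
    using T(3,4) star_le[OF T(1,2)] card_seteq[OF finite_star[OF fin]] by metis+
  then show ?thesis
    using T eq by blast
qed blast

end

section \<open>From pairs to \<open>k\<close> families\<close>

text \<open>Two values above \<open>M\<close> would violate the pair condition. A single value above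
  \<open>M\<close> is absorbed by pairing it with any other index, since that pair has product below
  \<open>M * M\<close>.\<close>

lemma prod_le_power_of_pairs:
  fixes f :: "'i \<Rightarrow> nat"
  assumes fin: "finite I" and two: "2 \<le> card I" and M: "0 < M"
    and pair: "\<And>i j. i \<in> I \<Longrightarrow> j \<in> I \<Longrightarrow> i \<noteq> j \<Longrightarrow> f i * f j < M * M \<or> f i = M \<and> f j = M"
  shows "prod f I < M ^ card I \<or> (\<forall>i\<in>I. f i = M)"
proof -
  have rest: "prod f J \<le> M ^ card J" if "\<And>l. l \<in> J \<Longrightarrow> f l \<le> M" for J
    using prod_mono[of J f "\<lambda>_. M"] that by simp
  consider "\<forall>l\<in>I. f l = M" | i where "i \<in> I" "f i < M" "\<forall>l\<in>I. f l \<le> M"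
    | i where "i \<in> I" "M < f i"
    by (meson linorder_neqE_nat not_le)
  then show ?thesis
  proof cases
    case 1
    then show ?thesis by blast
  next
    case 2
    have "prod f I = f i * prod f (I - {i})"
      using fin 2(1) by (rule prod.remove)
    also have "\<dots> \<le> f i * M ^ card (I - {i})"
      using 2 by (intro mult_le_mono2 rest) auto
    also have "\<dots> < M * M ^ card (I - {i})"
      using 2 M by simp
    also have "\<dots> = M ^ card I"
      using card.remove[OF fin 2(1)] by simp
    finally show ?thesis ..
  next
    case 3
    have "1 \<le> card (I - {i})"
      using two 3(1) fin by simp
    then obtain j where j: "j \<in> I - {i}"
      by (metis card.empty equals0I not_one_le_zero)
    have small: "f l \<le> M" if "l \<in> I - {i}" for l
    proof (rule ccontr)
      assume "\<not> f l \<le> M"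
      then have "M * M < f i * f l" using 3 by (intro mult_strict_mono) auto
      then show False using pair[of i l] that 3 by auto
    qed
    have "prod f I = f i * (f j * prod f (I - {i} - {j}))"
      using fin 3(1) j by (metis prod.remove finite_Diff)
    also have "\<dots> \<le> f i * (f j * M ^ card (I - {i} - {j}))"
      using small by (intro mult_le_mono2 rest) auto
    also have "\<dots> = (f i * f j) * M ^ card (I - {i} - {j})"
      by simp
    also have "\<dots> < (M * M) * M ^ card (I - {i} - {j})"
      using pair[of i j] 3 j M by auto
    also have "\<dots> = M ^ card I"
      unfolding card.remove[OF fin 3(1)] card.remove[OF finite_Diff[OF fin] j] by simp
    finally show ?thesis ..
  qed
qed

section \<open>Largest stars and the extrastrong property\<close>

lemma ex_max_star:
  fixes \<G> :: "'b set set" and T\<^sub>0 :: "'b set"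
  assumes "finite \<G>" and "finite T\<^sub>0" and "card T\<^sub>0 = t"
  obtains T where "finite T" "card T = t"
    "\<And>T'. finite T' \<Longrightarrow> card T' = t \<Longrightarrow> card (star \<G> T') \<le> card (star \<G> T)"
proof -
  have "\<forall>T. finite T \<and> card T = t \<longrightarrow> card (star \<G> T) < Suc (card \<G>)"
    using assms(1) by (auto simp: star_def less_Suc_eq_le intro: card_mono)
  then have "\<exists>T. (finite T \<and> card T = t) \<and>
      (\<forall>T'. finite T' \<and> card T' = t \<longrightarrow> card (star \<G> T') \<le> card (star \<G> T))"
    using assms(2,3) by (intro ex_has_greatest_nat[of _ T\<^sub>0]) auto
  then show ?thesis using that by metis
qed

lemma (in spread_family) extrastrong_cross_t_star_const:
  assumes k: "2 \<le> k" and \<H>: "\<forall>i\<in>{1..k}. \<H> i = \<G>"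
    and T: "finite T" "card T = t" "card (star \<G> T) = M"
  shows "extrastrong_cross_t_star t k \<H>"
  unfolding extrastrong_cross_t_star_def
proof (intro exI[of _ T] conjI[OF T(1)] conjI[OF T(2)] allI impI, elim conjE)
  fix \<A> assume bel: "below k \<A> \<H>" and cr: "cross_t_intersecting t k \<A>"
  have pair: "card (\<A> i) * card (\<A> j) < M * M \<or>
      (\<exists>T. finite T \<and> card T = t \<and> card (star \<G> T) = M \<and> \<A> i = star \<G> T \<and> \<A> j = star \<G> T)"
    if "i \<in> {1..k}" "j \<in> {1..k}" "i \<noteq> j" for i j
    using that bel cr \<H> unfolding below_def cross_t_intersecting_def
    by (intro card_mult_less_or_eq_star) auto
  have "(\<Prod>i=1..k. card (\<A> i)) < M ^ card {1..k} \<or> (\<forall>i\<in>{1..k}. card (\<A> i) = M)"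
    using pair k M_pos by (intro prod_le_power_of_pairs) fastforce+
  moreover have stars: "(\<Prod>i=1..k. card (star (\<H> i) T)) = M ^ card {1..k}"
    using \<H> T by simp
  moreover have "\<exists>T'. finite T' \<and> card T' = t \<and> (\<forall>i\<in>{1..k}. \<A> i = star (\<H> i) T')"
    if eq: "\<forall>i\<in>{1..k}. card (\<A> i) = M"
  proof -
    have same: "\<exists>T. finite T \<and> card T = t \<and> \<A> i = star \<G> T \<and> \<A> j = star \<G> T"
      if "i \<in> {1..k}" "j \<in> {1..k}" "i \<noteq> j" for i j
      using pair[OF that] eq that by auto
    \<comment> \<open>Different pairs might provide different \<open>t\<close>-sets. Fixing
      \<open>T'\<close> from the pair 1, 2 and comparing every other family with the first makes one
      \<open>T'\<close> serve all indices.\<close>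
    have "1 \<in> {1..k}" "2 \<in> {1..k}" using k by auto
    then obtain T' where T': "finite T'" "card T' = t" "\<A> 1 = star \<G> T'"
      using same[of 1 2] by auto
    have "\<A> i = star (\<H> i) T'" if "i \<in> {1..k}" for i
      using same[of 1 i] that T' \<H> \<open>1 \<in> {1..k}\<close> by (cases "i = 1") auto
    then show ?thesis using T' by blast
  qed
  ultimately show "(\<Prod>i=1..k. card (\<A> i)) \<le> (\<Prod>i=1..k. card (star (\<H> i) T)) \<and>
      ((\<Prod>i=1..k. card (\<A> i)) = (\<Prod>i=1..k. card (star (\<H> i) T)) \<longrightarrow>
        (\<exists>T'. finite T' \<and> card T' = t \<and> (\<forall>i\<in>{1..k}. \<A> i = star (\<H> i) T')))"
    by auto
qed

lemma extrastrong_cross_t_star_empty: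
  fixes \<H> :: "nat \<Rightarrow> 'b set set" and T :: "'b set"
  assumes "\<forall>i\<in>{1..k}. \<H> i = {}" and "2 \<le> k" and "finite T" and "card T = t"
  shows "extrastrong_cross_t_star t k \<H>"
  unfolding extrastrong_cross_t_star_def
proof (intro exI[of _ T] conjI[OF assms(3)] conjI[OF assms(4)] allI impI, elim conjE)
  fix \<A> assume "below k \<A> \<H>"
  then have "\<forall>i\<in>{1..k}. \<A> i = {}"
    using assms(1) by (auto simp: below_def)
  moreover have "\<forall>i\<in>{1..k}. star (\<H> i) T = {}"
    using assms(1) by (auto simp: star_def)
  ultimately show "(\<Prod>i=1..k. card (\<A> i)) \<le> (\<Prod>i=1..k. card (star (\<H> i) T)) \<and>
      ((\<Prod>i=1..k. card (\<A> i)) = (\<Prod>i=1..k. card (star (\<H> i) T)) \<longrightarrow>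
        (\<exists>T'. finite T' \<and> card T' = t \<and> (\<forall>i\<in>{1..k}. \<A> i = star (\<H> i) T')))"
    using assms(2-4) by auto
qed

text \<open>Labelling all of \<open>F\<close> by 1 gives a signed set with at least \<open>t\<close>
  points, and any \<open>t\<close> of them form a suitable \<open>T\<close>. This makes the largest
  star size positive.\<close>

lemma ex_nonempty_star_signed_family:
  assumes "F \<in> \<F>" and "finite F" and "1 \<le> t" and "t \<le> card F" and "1 \<le> m"
  obtains T where "finite T" "card T = t" "star (signed_family \<F> m) T \<noteq> {}"
proof -
  let ?S = "(\<lambda>x. (x, 1 :: nat)) ` F"
  have "F \<noteq> {}" using assms by auto
  then have S: "?S \<in> signed_family \<F> m"
    using assms by (auto simp: mem_signed_family_iff inj_on_def image_image)
  have "card ?S = card F"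
    by (intro card_image) (auto simp: inj_on_def)
  then obtain T where "T \<subseteq> ?S" "card T = t" "finite T"
    using obtain_subset_with_card_n assms(4) by metis
  moreover from this have "?S \<in> star (signed_family \<F> m) T"
    using S by (simp add: star_def)
  ultimately show ?thesis using that by blast
qed

text \<open>The hypothesis \<open>nondegenerate\<close> excludes a nonempty signed family whose
  members all have fewer than \<open>t\<close> points. There all \<open>t\<close>-stars are empty,
  and a tuple with one nonempty family and the rest empty attains equality 0 = 0 without consisting
  of stars.\<close>

theorem theorem4p4:
  fixes \<F> :: "'a set set" and \<G> :: "nat \<Rightarrow> ('a \<times> nat) set set" and r t m k :: nat
  assumes "1 \<le> t" and "t \<le> r"
    and "le_family r \<F>"
    and "r * (r choose t) + 1 \<le> m"
    and "2 \<le> k"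
    and "\<forall>i\<in>{1..k}. \<G> i = signed_family \<F> m"
    and nondegenerate: "signed_family \<F> m \<noteq> {} \<longrightarrow> (\<exists>F\<in>\<F>. t \<le> card F)"
  shows "extrastrong_cross_t_star t k \<G>"
proof (cases "signed_family \<F> m = {}")
  case True
  \<comment> \<open>The definition asks for a \<open>t\<close>-set even when there are no signed
    sets; \<open>t\<close> labels over one arbitrary point supply it, whatever the size of the type
    \<open>'a\<close>.\<close>
  have "finite ((\<lambda>n. (undefined :: 'a, n)) ` {..<t})" "card ((\<lambda>n. (undefined :: 'a, n)) ` {..<t}) = t"
    by (auto simp: card_image inj_on_def)
  then show ?thesis
    using assms(5,6) True by (intro extrastrong_cross_t_star_empty) auto
next
  case False
  let ?G = "signed_family \<F> m"
  note finG = finite_signed_family[OF assms(3)]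
  obtain F where F: "F \<in> \<F>" "t \<le> card F"
    using nondegenerate False by blast
  then have "finite F"
    using assms(3) by (auto simp: le_family_def)
  then obtain T\<^sub>0 where T\<^sub>0: "finite T\<^sub>0" "card T\<^sub>0 = t" "star ?G T\<^sub>0 \<noteq> {}"
    using ex_nonempty_star_signed_family[of F \<F> t m] F assms(1,4) by auto
  obtain T where T: "finite T" "card T = t"
    and max: "\<And>T'. finite T' \<Longrightarrow> card T' = t \<Longrightarrow> card (star ?G T') \<le> card (star ?G T)"
    using ex_max_star[OF finG T\<^sub>0(1,2)] by blast
  have "0 < card (star ?G T)"
    using max[OF T\<^sub>0(1,2)] T\<^sub>0(3) finite_star[OF finG] by (metis card_gt_0_iff le_zero_eq not_gr_zero)
  moreover have "m * card (star ?G (insert p T')) \<le> card (star ?G T)"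
    if "finite T'" "card T' = t" "p \<notin> T'" for T' p
    using card_star_insert_signed_family[OF assms(3) that(3)] max[OF that(1,2)] by (rule order_trans)
  ultimately interpret spread_family ?G r t m "card (star ?G T)"
    using finG signed_family_finite_card[OF assms(3)] max assms(4) by unfold_locales auto
  show ?thesis
    using extrastrong_cross_t_star_const[OF assms(5,6) T] by simp
qed

end
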